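(* For every integer $k\ge 2$ there exists a constant $c=c(k)>0$ such that the following holds. Let $G_<$ be an ordered graph on $n$ vertices whose maximum degree satisfies $\Delta(G_<)<cn$, and suppose $G_<$ does not contain the monotone path $P_k$ as an induced ordered subgraph. Then the complement of $G_<$ contains a bi-clique of size at least $cn/\log n$.
   Context: An ordered graph $G_<$ is a graph $G$ together with a total ordering $<$ of its vertex set. An ordered graph $H_{<'}$ is an induced ordered subgraph of $G_<$ if there is an injection $\phi:V(H)\to V(G)$ such that $u<'v$ implies $\phi(u)<\phi(v)$, and $uv\in E(H)$ if and only if $\phi(u)\phi(v)\in E(G)$. The monotone path $P_k$ is the ordered graph on vertices $v_1<v_2<\dots<v_k$ in which $v_iv_j$ is an edge if and only if $|i-j|=1$. A bi-clique in a graph is a pair $(A,B)$ of disjoint vertex sets with $|A|=|B|$ such that every $a\in A$ is adjacent to every $b\in B$; its size is $|A|$. $\Delta$ denotes the maximum degree. *)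

theory Defs
  imports Complex_Main
begin

text \<open>An ordered graph on n vertices: vertex set {0..<n} ordered by the natural order
(every finite totally ordered vertex set is order-isomorphic to this), with a
symmetric irreflexive adjacency relation E on it.\<close>

definition ordered_graph :: "nat \<Rightarrow> (nat \<Rightarrow> nat \<Rightarrow> bool) \<Rightarrow> bool" where
  "ordered_graph n E \<longleftrightarrow>
     (\<forall>u<n. \<forall>v<n. E u v \<longleftrightarrow> E v u) \<and> (\<forall>v<n. \<not> E v v)"

definition degree :: "nat \<Rightarrow> (nat \<Rightarrow> nat \<Rightarrow> bool) \<Rightarrow> nat \<Rightarrow> nat" where
  "degree n E v = card {u. u < n \<and> E v u}"

definition max_degree :: "nat \<Rightarrow> (nat \<Rightarrow> nat \<Rightarrow> bool) \<Rightarrow> nat" where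
  "max_degree n E = Max (insert 0 ((degree n E) ` {..<n}))"

definition contains_induced_monotone_path ::
  "nat \<Rightarrow> (nat \<Rightarrow> nat \<Rightarrow> bool) \<Rightarrow> nat \<Rightarrow> bool" where
  "contains_induced_monotone_path n E k \<longleftrightarrow>
     (\<exists>f :: nat \<Rightarrow> nat.
        (\<forall>i<k. f i < n) \<and>
        (\<forall>i<k. \<forall>j<k. i < j \<longrightarrow> f i < f j) \<and>
        (\<forall>i<k. \<forall>j<k. E (f i) (f j) \<longleftrightarrow> (i = j + 1 \<or> j = i + 1)))"

definition complement_biclique ::
  "nat \<Rightarrow> (nat \<Rightarrow> nat \<Rightarrow> bool) \<Rightarrow> nat set \<Rightarrow> nat set \<Rightarrow> bool" where
  "complement_biclique n E A B \<longleftrightarrow>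
     A \<subseteq> {..<n} \<and> B \<subseteq> {..<n} \<and> A \<inter> B = {} \<and> card A = card B \<and>
     (\<forall>a\<in>A. \<forall>b\<in>B. a \<noteq> b \<and> \<not> E a b)"

end

theory Submission
  imports Defs
begin

text \<open>Grow the path greedily from a vertex \<open>v\<close> that reaches a large set \<open>S\<close> by monotone walks inside
  \<open>S\<close>. Every vertex of \<open>T = S - N(v)\<close> is reached from some \<open>w \<in> N(v) \<inter> S\<close> by a monotone walk inside
  \<open>T\<close>, and it suffices to find one \<open>w\<close> that on its own reaches almost all of \<open>T\<close>. Cut \<open>T\<close> from left
  to right into about \<open>log n\<close> blocks of size about \<open>3s\<close>, where \<open>s = c n / log n\<close>, and a remainder.
  Halve the set of candidates for \<open>w\<close> at each block: one of the halves reaches \<open>s\<close> vertices of the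
  current block, hence, as the complement has no bi-clique of size \<open>s\<close>, all but \<open>s\<close> vertices of the
  next one. A single candidate is left after \<open>log n\<close> halvings, and it reaches all but \<open>s\<close> vertices of
  the remainder.\<close>

section \<open>Initial segments of finite linear orders\<close>

lemma initial_segment_of_card:
  fixes T :: "'a::linorder set"
  assumes "finite T" "j \<le> card T"
  obtains X where "X \<subseteq> T" "card X = j" "\<And>x y. x \<in> X \<Longrightarrow> y \<in> T - X \<Longrightarrow> x < y"
proof -
  have "\<exists>X\<subseteq>T. card X = j \<and> (\<forall>x\<in>X. \<forall>y\<in>T - X. x < y)"
    using assms(2)
  proof (induction j)
    case 0
    then show ?case by (intro exI[of _ "{}"]) auto
  next
    case (Suc j)
    then obtain X where X: "X \<subseteq> T" "card X = j" "\<forall>x\<in>X. \<forall>y\<in>T - X. x < y"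
      by auto
    have fin: "finite X" "finite (T - X)"
      using X(1) assms(1) by (auto intro: finite_subset)
    have ne: "T - X \<noteq> {}"
      using X Suc.prems fin(1) by (metis Diff_eq_empty_iff card_mono not_less_eq_eq)
    define m where "m = Min (T - X)"
    have m: "m \<in> T - X" and le: "\<And>y. y \<in> T - X \<Longrightarrow> m \<le> y"
      using Min_in[OF fin(2) ne] fin by (auto simp: m_def)
    show ?case
    proof (intro exI[of _ "insert m X"] conjI ballI)
      show "insert m X \<subseteq> T" "card (insert m X) = Suc j"
        using X m fin by auto
      fix x y assume "x \<in> insert m X" "y \<in> T - insert m X"
      then show "x < y" using X(3) le[of y] by fastforce
    qed
  qed
  with that show ?thesis by blast
qed

section \<open>Monotone reachability\<close>

text \<open>Only the right end of a step has to lie in \<open>T\<close>, so a walk may enter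
  \<open>T\<close> from a start outside it. This is needed later, where the start \<open>w\<close>
  is a neighbour of \<open>v\<close> and \<open>T\<close> consists of non-neighbours.\<close>

definition fwd :: "('a::linorder \<Rightarrow> 'a \<Rightarrow> bool) \<Rightarrow> 'a set \<Rightarrow> ('a \<times> 'a) set" where
  "fwd E T = {(x, y). x < y \<and> E x y \<and> y \<in> T}"

definition reach :: "('a::linorder \<Rightarrow> 'a \<Rightarrow> bool) \<Rightarrow> 'a set \<Rightarrow> 'a \<Rightarrow> 'a set" where
  "reach E T w = (fwd E T)\<^sup>+ `` {w}"

lemma reach_subset: "reach E T w \<subseteq> T"
  by (auto simp: reach_def fwd_def elim: tranclE)

lemma reach_greater: "x \<in> reach E T w \<Longrightarrow> w < x"
  unfolding reach_def Image_singleton_iff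
  by (induction rule: trancl_induct) (auto simp: fwd_def)

lemma reach_base: "w < x \<Longrightarrow> E w x \<Longrightarrow> x \<in> T \<Longrightarrow> x \<in> reach E T w"
  by (auto simp: reach_def fwd_def)

lemma reach_step: "x \<in> reach E T w \<Longrightarrow> x < y \<Longrightarrow> E x y \<Longrightarrow> y \<in> T \<Longrightarrow> y \<in> reach E T w"
  by (auto simp: reach_def fwd_def intro: trancl_into_trancl)

lemma reach_induct [consumes 1, case_names base step]:
  assumes "x \<in> reach E T w"
    and "\<And>x. w < x \<Longrightarrow> E w x \<Longrightarrow> x \<in> T \<Longrightarrow> P x"
    and "\<And>x y. x \<in> reach E T w \<Longrightarrow> P x \<Longrightarrow> x < y \<Longrightarrow> E x y \<Longrightarrow> y \<in> T \<Longrightarrow> P y"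
  shows "P x"
  using assms(1) unfolding reach_def Image_singleton_iff
proof (induction rule: trancl_induct)
  case (base y)
  then show ?case using assms(2) by (auto simp: fwd_def)
next
  case (step y z)
  then show ?case using assms(3)[of y z] by (auto simp: fwd_def reach_def)
qed

text \<open>Each vertex on a walk from \<open>w\<close> is itself reached, so the walk never leaves
  the reached set. This lets a reached set serve as the next \<open>S\<close> in the greedy
  construction.\<close>

lemma reach_within_reach: "reach E T w \<subseteq> reach E (reach E T w) w"
proof
  fix x assume "x \<in> reach E T w"
  then show "x \<in> reach E (reach E T w) w"
  proof (induction rule: reach_induct)
    case (base x)
    then show ?case by (intro reach_base) auto
  next
    case (step x y)
    then show ?case by (metis reach_step)
  qed
qed

text \<open>Take for \<open>w\<close> the last neighbour of \<open>v\<close> on a walk from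
  \<open>v\<close> to \<open>x\<close>; from there on the walk meets non-neighbours of
  \<open>v\<close> only.\<close>

lemma reach_avoiding_neighbours:
  assumes "x \<in> reach E S v" "\<not> E v x"
  shows "\<exists>w\<in>S. v < w \<and> E v w \<and> x \<in> reach E {y \<in> S. \<not> E v y} w"
  using assms
proof (induction rule: reach_induct)
  case (base x)
  then show ?case by simp
next
  case (step x y)
  show ?case
  proof (cases "E v x")
    case True
    then show ?thesis
      using step reach_greater[of x E S v] reach_subset[of E S v]
      by (intro bexI[of _ x]) (auto intro: reach_base)
  next
    case False
    with step obtain w where "w \<in> S" "v < w" "E v w" "x \<in> reach E {y \<in> S. \<not> E v y} w"
      by blast
    with step show ?thesis by (intro bexI[of _ w]) (auto intro: reach_step)
  qed
qed

section \<open>One vertex that reaches almost everything\<close>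

text \<open>\<open>X\<close> is the current block, \<open>Y\<close> all that lies to its right, and
  \<open>N\<close> the remaining candidates. Each halving costs one block of at most
  \<open>3 * s + 1\<close> vertices, and the final passage into \<open>Y\<close> costs
  \<open>s\<close>. The family \<open>R\<close> is kept abstract because it is used both for the
  reached sets and for these sets with their start added.\<close>

lemma halving:
  fixes E :: "'a::linorder \<Rightarrow> 'a \<Rightarrow> bool" and s :: real
  assumes dense: "\<And>A B. A \<subseteq> T \<Longrightarrow> B \<subseteq> T \<Longrightarrow> (\<And>a b. a \<in> A \<Longrightarrow> b \<in> B \<Longrightarrow> a < b) \<Longrightarrow>
      s \<le> card A \<Longrightarrow> s \<le> card B \<Longrightarrow> \<exists>a\<in>A. \<exists>b\<in>B. E a b"
    and s: "0 < s" and T: "finite T"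
    and R: "\<And>w. R w \<subseteq> T"
      "\<And>w x y. x \<in> R w \<Longrightarrow> y \<in> T \<Longrightarrow> x < y \<Longrightarrow> E x y \<Longrightarrow> y \<in> R w"
    and N: "finite N" "card N \<le> 2 ^ m"
    and X: "X \<subseteq> (\<Union>w\<in>N. R w)" "2 * s \<le> card X"
    and Y: "Y \<subseteq> T" "\<And>x y. x \<in> X \<Longrightarrow> y \<in> Y \<Longrightarrow> x < y"
  shows "\<exists>w\<in>N. card Y - (3 * s + 1) * m - s \<le> card (R w)"
  using N X Y
proof (induction m arbitrary: N X Y)
  \<comment> \<open>An edge from a covered vertex to an uncovered one on its right would cover the
    latter too, so \<open>dense\<close> leaves fewer than \<open>s\<close> uncovered
    vertices.\<close>
  have miss: "card (Y - (\<Union>w\<in>N. R w)) < s"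
    if asm: "X \<subseteq> (\<Union>w\<in>N. R w)" "s \<le> card X" "Y \<subseteq> T" "\<And>x y. x \<in> X \<Longrightarrow> y \<in> Y \<Longrightarrow> x < y"
    for X Y N
  proof (rule ccontr)
    assume large: "\<not> ?thesis"
    have "\<exists>a\<in>X. \<exists>b\<in>Y - (\<Union>w\<in>N. R w). E a b"
    proof (rule dense)
      show "X \<subseteq> T" using asm(1) R(1) by blast
      show "Y - (\<Union>w\<in>N. R w) \<subseteq> T" using asm(3) by blast
      show "a < b" if "a \<in> X" "b \<in> Y - (\<Union>w\<in>N. R w)" for a b
        using that asm(4) by blast
      show "s \<le> card (Y - (\<Union>w\<in>N. R w))" using large by simp
    qed (rule asm(2))
    then obtain a b where ab: "a \<in> X" "b \<in> Y" "b \<notin> (\<Union>w\<in>N. R w)" "E a b" by blast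
    obtain w where w: "w \<in> N" "a \<in> R w" using asm(1) ab(1) by blast
    have "b \<in> R w"
      using w(2) subsetD[OF asm(3) ab(2)] asm(4)[OF ab(1,2)] ab(4) by (rule R(2))
    with w(1) ab(3) show False by blast
  qed
  {
    case 0
    have "N \<noteq> {}" using 0 s by auto
    then have "card N = 1" using 0 by (simp add: le_eq_less_or_eq)
    then obtain w where N: "N = {w}" by (auto simp: card_1_singleton_iff)
    have fin: "finite Y" using 0 T finite_subset by blast
    have "card Y \<le> card (R w) + card (Y - R w)"
    proof -
      have "card Y = card (Y \<inter> R w) + card (Y - R w)"
        using fin by (rule card_Int_Diff)
      moreover have "card (Y \<inter> R w) \<le> card (R w)"
        by (intro card_mono finite_subset[OF R(1) T]) auto
      ultimately show ?thesis by simp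
    qed
    moreover have "card (Y - R w) < s"
      using miss[of X N Y] 0 s by (simp add: N)
    ultimately show ?case by (simp add: N)
  next
    case (Suc m)
    show ?case
    \<comment> \<open>If \<open>Y\<close> is too short to cut off another block, the claimed lower
      bound is at most 0 and any candidate works.\<close>
    proof (cases "3 * s + 1 \<le> card Y")
      case False
      have "N \<noteq> {}" using Suc.prems s by auto
      then obtain w where "w \<in> N" by blast
      have "card Y \<le> (3 * s + 1) * 1" using False by simp
      also have "\<dots> \<le> (3 * s + 1) * real (Suc m)"
        using s by (intro mult_left_mono) auto
      finally have "card Y - (3 * s + 1) * real (Suc m) - s \<le> 0" using s by simp
      also have "\<dots> \<le> card (R w)" by simp
      finally have "card Y - (3 * s + 1) * real (Suc m) - s \<le> card (R w)" .
      with \<open>w \<in> N\<close> show ?thesis by blast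
    next
      case True
      have finX: "finite X" using Suc.prems(4) s by (intro card_ge_0_finite) linarith
      have finY: "finite Y" using Suc.prems T finite_subset by blast
      \<comment> \<open>Split \<open>N\<close> into a lower and an upper half; even the one rounded
        up has at most \<open>2 ^ m\<close> elements. Since together they cover the at least
        \<open>2 * s\<close> vertices of \<open>X\<close>, one of them covers
        \<open>s\<close>.\<close>
      obtain N1 where N1: "N1 \<subseteq> N" "card N1 = card N div 2"
        using obtain_subset_with_card_n[of "card N div 2" N] by auto
      have N2: "card (N - N1) = card N - card N div 2"
        using N1 Suc.prems(1) by (metis card_Diff_subset finite_subset)
      have "\<exists>M\<subseteq>N. card M \<le> 2 ^ m \<and> s \<le> card (X \<inter> (\<Union>w\<in>M. R w))"
      proof (cases "s \<le> card (X \<inter> (\<Union>w\<in>N1. R w))")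
        case True
        then show ?thesis using N1 Suc.prems(2) by (intro exI[of _ N1]) auto
      next
        case False
        have "card X \<le> card (X \<inter> (\<Union>w\<in>N1. R w)) + card (X \<inter> (\<Union>w\<in>N - N1. R w))"
        proof (rule order_trans[OF _ card_Un_le])
          show "card X \<le> card ((X \<inter> (\<Union>w\<in>N1. R w)) \<union> (X \<inter> (\<Union>w\<in>N - N1. R w)))"
            using Suc.prems(3) finX by (intro card_mono) auto
        qed
        then have "s \<le> card (X \<inter> (\<Union>w\<in>N - N1. R w))"
          using False Suc.prems(4) by linarith
        then show ?thesis using N2 Suc.prems(2) by (intro exI[of _ "N - N1"]) auto
      qed
      then obtain M where M: "M \<subseteq> N" "card M \<le> 2 ^ m" "s \<le> card (X \<inter> (\<Union>w\<in>M. R w))"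
        by blast
      have "nat \<lceil>3 * s\<rceil> \<le> card Y"
        using True by linarith
      then obtain Y1 where Y1: "Y1 \<subseteq> Y" "card Y1 = nat \<lceil>3 * s\<rceil>"
          "\<And>x y. x \<in> Y1 \<Longrightarrow> y \<in> Y - Y1 \<Longrightarrow> x < y"
        using initial_segment_of_card[OF finY] by blast
      have finY1: "finite Y1" using Y1(1) finY finite_subset by blast
      \<comment> \<open>The block \<open>Y1\<close> has at least \<open>3 * s\<close> vertices and
        fewer than \<open>s\<close> are missed by \<open>M\<close>, so the covered part again has
        the \<open>2 * s\<close> vertices required for the next halving.\<close>
      define X' where "X' = Y1 \<inter> (\<Union>w\<in>M. R w)"
      have "card (Y1 - (\<Union>w\<in>M. R w)) < s"
        using miss[of "X \<inter> (\<Union>w\<in>M. R w)" M Y1] M(3) Y1(1) Suc.prems(5,6) by blast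
      moreover have "card Y1 = card X' + card (Y1 - (\<Union>w\<in>M. R w))"
        unfolding X'_def using finY1 by (rule card_Int_Diff)
      moreover have "3 * s \<le> card Y1" using Y1(2) by linarith
      ultimately have X': "2 * s \<le> card X'" by linarith
      have "\<exists>w\<in>M. card (Y - Y1) - (3 * s + 1) * m - s \<le> card (R w)"
      proof (rule Suc.IH[OF _ M(2) _ X'])
        show "finite M" using M(1) Suc.prems(1) finite_subset by blast
        show "X' \<subseteq> (\<Union>w\<in>M. R w)" by (simp add: X'_def)
        show "Y - Y1 \<subseteq> T" using Suc.prems(5) by blast
        show "x < y" if "x \<in> X'" "y \<in> Y - Y1" for x y
          using that Y1(3) by (simp add: X'_def)
      qed
      then obtain w where w: "w \<in> M" "card (Y - Y1) - (3 * s + 1) * m - s \<le> card (R w)"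
        by blast
      have "card (Y - Y1) = card Y - card Y1"
        using Y1(1) finY1 by (rule card_Diff_subset[rotated])
      moreover have "card Y1 \<le> card Y" using Y1(1) finY by (rule card_mono[rotated])
      moreover have "card Y1 \<le> 3 * s + 1" using Y1(2) s by linarith
      ultimately have "card Y - (3 * s + 1) \<le> card (Y - Y1)" by linarith
      with w(2) have "card Y - (3 * s + 1) * real (Suc m) - s \<le> card (R w)"
        by (simp add: algebra_simps)
      with w(1) M(1) show ?thesis by blast
    qed
  }
qed

text \<open>Starts the halving with the leftmost \<open>2 * s\<close> vertices, rounded up, as first
  block. Its loss of \<open>2 * s + 1\<close> and the final loss of \<open>s\<close> add up to one
  more \<open>3 * s + 1\<close>, hence the factor \<open>Suc m\<close>.\<close>

lemma single_vertex_reaches_most: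
  fixes E :: "'a::linorder \<Rightarrow> 'a \<Rightarrow> bool" and s :: real
  assumes dense: "\<And>A B. A \<subseteq> T \<Longrightarrow> B \<subseteq> T \<Longrightarrow> (\<And>a b. a \<in> A \<Longrightarrow> b \<in> B \<Longrightarrow> a < b) \<Longrightarrow>
      s \<le> card A \<Longrightarrow> s \<le> card B \<Longrightarrow> \<exists>a\<in>A. \<exists>b\<in>B. E a b"
    and s: "0 < s" and T: "finite T"
    and R: "\<And>w. R w \<subseteq> T"
      "\<And>w x y. x \<in> R w \<Longrightarrow> y \<in> T \<Longrightarrow> x < y \<Longrightarrow> E x y \<Longrightarrow> y \<in> R w"
    and N: "finite N" "card N \<le> 2 ^ m" and cover: "T \<subseteq> (\<Union>w\<in>N. R w)"
    and large: "2 * s + 1 \<le> card T"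
  shows "\<exists>w\<in>N. card T - (3 * s + 1) * Suc m \<le> card (R w)"
proof -
  have "nat \<lceil>2 * s\<rceil> \<le> card T" using large by linarith
  then obtain X where X: "X \<subseteq> T" "card X = nat \<lceil>2 * s\<rceil>"
      "\<And>x y. x \<in> X \<Longrightarrow> y \<in> T - X \<Longrightarrow> x < y"
    using initial_segment_of_card[OF T] by blast
  have "\<exists>w\<in>N. card (T - X) - (3 * s + 1) * m - s \<le> card (R w)"
  proof (rule halving[OF dense s T R N])
    show "2 * s \<le> card X" using X(2) by linarith
    show "X \<subseteq> (\<Union>w\<in>N. R w)" using X(1) cover by blast
  qed (use X(3) in auto)
  then obtain w where w: "w \<in> N" "card (T - X) - (3 * s + 1) * m - s \<le> card (R w)"
    by blast
  have "card (T - X) = card T - card X"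
    using X(1) T by (metis card_Diff_subset finite_subset)
  moreover have "card X \<le> 2 * s + 1" using X(2) s by linarith
  ultimately have "card T - (2 * s + 1) \<le> card (T - X)" by linarith
  with w(2) have "card T - (3 * s + 1) * Suc m \<le> card (R w)"
    by (simp add: algebra_simps)
  with w(1) show ?thesis by (intro bexI[of _ w])
qed

section \<open>Greedy construction of an induced monotone path\<close>

text \<open>The invariant \<open>S \<subseteq> reach E S v\<close> says that \<open>v\<close>
  reaches all of \<open>S\<close> without leaving \<open>S\<close>. Moving on from \<open>v\<close>
  to a suitable neighbour \<open>w\<close> costs at most \<open>d\<close> vertices for the
  neighbours of \<open>v\<close> and \<open>D\<close> for those that \<open>w\<close> misses, so
  \<open>D + d\<close> per edge of the path is enough.\<close>

lemma induced_path_from_vertex: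
  fixes E :: "'a::linorder \<Rightarrow> 'a \<Rightarrow> bool" and s d D :: real and i :: nat
  assumes dense: "\<And>A B. A \<subseteq> V \<Longrightarrow> B \<subseteq> V \<Longrightarrow> (\<And>a b. a \<in> A \<Longrightarrow> b \<in> B \<Longrightarrow> a < b) \<Longrightarrow>
      s \<le> card A \<Longrightarrow> s \<le> card B \<Longrightarrow> \<exists>a\<in>A. \<exists>b\<in>B. E a b"
    and s: "0 < s" and V: "finite V" "card V \<le> 2 ^ m"
    and sym: "\<And>x y. x \<in> V \<Longrightarrow> y \<in> V \<Longrightarrow> E x y \<longleftrightarrow> E y x"
    and irrefl: "\<And>x. x \<in> V \<Longrightarrow> \<not> E x x"
    and deg: "\<And>v. v \<in> V \<Longrightarrow> card {u \<in> V. E v u} \<le> d"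
    and D: "D = (3 * s + 1) * Suc m"
    and S: "v \<in> V" "S \<subseteq> V" "S \<subseteq> reach E S v" "i * (D + d) \<le> card S"
  shows "\<exists>f :: nat \<Rightarrow> 'a. f 0 = v \<and> (\<forall>j. 0 < j \<and> j \<le> i \<longrightarrow> f j \<in> S) \<and>
      (\<forall>a\<le>i. \<forall>b\<le>i. a < b \<longrightarrow> f a < f b) \<and>
      (\<forall>a\<le>i. \<forall>b\<le>i. E (f a) (f b) \<longleftrightarrow> a = b + 1 \<or> b = a + 1)"
  using S
proof (induction i arbitrary: v S)
  case 0
  then show ?case using irrefl by (intro exI[of _ "\<lambda>_. v"]) auto
next
  case (Suc i)
  define N where "N = {w \<in> S. E v w}"
  define T where "T = {w \<in> S. \<not> E v w}"
  have fin: "finite S" "finite N" "finite T"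
    using Suc.prems(2) V(1) by (auto simp: N_def T_def intro: finite_subset)
  have "card N \<le> card V"
    using Suc.prems(2) V(1) by (intro card_mono) (auto simp: N_def)
  \<comment> \<open>\<open>m\<close> halvings therefore reduce the neighbours of \<open>v\<close> to
    a single candidate.\<close>
  with V(2) have cardN: "card N \<le> 2 ^ m" by linarith
  have "card N \<le> card {u \<in> V. E v u}"
    using Suc.prems(2) V(1) by (intro card_mono) (auto simp: N_def)
  with deg[OF Suc.prems(1)] have "card N \<le> d" by linarith
  moreover have "card S = card N + card T"
    unfolding N_def T_def using fin(1)
    by (subst card_Un_disjoint[symmetric]) (auto intro!: arg_cong[of _ _ card])
  ultimately have cardT: "i * (D + d) + D \<le> card T"
    using Suc.prems(4) by (simp add: algebra_simps)
  have "0 \<le> d" using \<open>card N \<le> d\<close> by linarith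
  have "(3 * s + 1) * 1 \<le> D"
    unfolding D using s by (intro mult_left_mono) auto
  then have "2 * s + 1 \<le> D" using s by simp
  also have "\<dots> \<le> i * (D + d) + D" using \<open>0 \<le> d\<close> s D by simp
  also note cardT
  finally have large: "2 * s + 1 \<le> card T" .
  have "\<exists>w\<in>N. card T - (3 * s + 1) * Suc m \<le> card (reach E T w)"
  proof (rule single_vertex_reaches_most[where E = E])
    show "\<exists>a\<in>A. \<exists>b\<in>B. E a b" if "A \<subseteq> T" "B \<subseteq> T" "\<And>a b. a \<in> A \<Longrightarrow> b \<in> B \<Longrightarrow> a < b"
      "s \<le> card A" "s \<le> card B" for A B
      using that Suc.prems(2) by (intro dense) (auto simp: T_def)
    show "T \<subseteq> (\<Union>w\<in>N. reach E T w)"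
      using Suc.prems(3) reach_avoiding_neighbours[of _ E S v]
      by (fastforce simp: T_def N_def)
    show "reach E T w \<subseteq> T" for w by (rule reach_subset)
    show "y \<in> reach E T w" if "x \<in> reach E T w" "y \<in> T" "x < y" "E x y" for w x y
      using that by (metis reach_step)
  qed (use s fin cardN large in auto)
  then obtain w where w: "w \<in> N" "card T - D \<le> card (reach E T w)"
    unfolding D by blast
  have wS: "w \<in> S" "E v w" "v < w"
    using w(1) Suc.prems(3) reach_greater[of w E S v] by (auto simp: N_def)
  have RT: "reach E T w \<subseteq> T" by (rule reach_subset)
  have "\<exists>f :: nat \<Rightarrow> 'a. f 0 = w \<and> (\<forall>j. 0 < j \<and> j \<le> i \<longrightarrow> f j \<in> reach E T w) \<and>
      (\<forall>a\<le>i. \<forall>b\<le>i. a < b \<longrightarrow> f a < f b) \<and>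
      (\<forall>a\<le>i. \<forall>b\<le>i. E (f a) (f b) \<longleftrightarrow> a = b + 1 \<or> b = a + 1)"
  proof (rule Suc.IH)
    show "w \<in> V" using wS Suc.prems(2) by blast
    show "reach E T w \<subseteq> V" using RT Suc.prems(2) by (auto simp: T_def)
    show "i * (D + d) \<le> card (reach E T w)" using w(2) cardT by linarith
  qed (rule reach_within_reach)
  then obtain f :: "nat \<Rightarrow> 'a"
    where f: "f 0 = w" "\<forall>j. 0 < j \<and> j \<le> i \<longrightarrow> f j \<in> reach E T w"
      "\<forall>a\<le>i. \<forall>b\<le>i. a < b \<longrightarrow> f a < f b"
      "\<forall>a\<le>i. \<forall>b\<le>i. E (f a) (f b) \<longleftrightarrow> a = b + 1 \<or> b = a + 1"
    by (elim exE conjE)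
  have fT: "f j \<in> T" if "0 < j" "j \<le> i" for j using f(2) RT that by blast
  have fS: "f j \<in> S" if "j \<le> i" for j
    using fT[of j] f(1) wS(1) that by (cases j) (auto simp: T_def)
  have fV: "f j \<in> V" if "j \<le> i" for j using fS[OF that] Suc.prems(2) by blast
  \<comment> \<open>After \<open>w\<close> the path stays in \<open>T\<close>, which has no
    neighbour of \<open>v\<close>; so prepending \<open>v\<close> keeps the path induced.\<close>
  have Ev: "E v (f j) \<longleftrightarrow> j = 0" if "j \<le> i" for j
    using fT[of j] f(1) wS(2) that by (cases j) (auto simp: T_def)
  have Ev': "E (f j) v \<longleftrightarrow> j = 0" if "j \<le> i" for j
    using Ev[OF that] sym[OF Suc.prems(1) fV[OF that]] by simp
  have vf: "v < f j" if "j \<le> i" for j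
    using fS[OF that] Suc.prems(3) reach_greater[of "f j" E S v] by blast
  show ?case
  proof (intro exI[of _ "case_nat v f"] conjI allI impI)
    show "case_nat v f 0 = v" by simp
    show "case_nat v f j \<in> S" if "0 < j \<and> j \<le> Suc i" for j
      using that fS by (cases j) auto
    show "case_nat v f a < case_nat v f b" if "a \<le> Suc i" "b \<le> Suc i" "a < b" for a b
      using that vf f(3) by (cases a; cases b) auto
    show "E (case_nat v f a) (case_nat v f b) \<longleftrightarrow> a = b + 1 \<or> b = a + 1"
      if "a \<le> Suc i" "b \<le> Suc i" for a b
      using that Ev Ev' f(4) irrefl[OF Suc.prems(1)] by (cases a; cases b) auto
  qed
qed

text \<open>The first vertex of the path is found by the same halving, now with all of
  \<open>V\<close> as candidates; this accounts for the additional \<open>D\<close> in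
  \<open>large\<close>.\<close>

lemma induced_path_if_no_sparse_pair:
  fixes E :: "'a::linorder \<Rightarrow> 'a \<Rightarrow> bool" and s d D :: real and i :: nat
  assumes dense: "\<And>A B. A \<subseteq> V \<Longrightarrow> B \<subseteq> V \<Longrightarrow> (\<And>a b. a \<in> A \<Longrightarrow> b \<in> B \<Longrightarrow> a < b) \<Longrightarrow>
      s \<le> card A \<Longrightarrow> s \<le> card B \<Longrightarrow> \<exists>a\<in>A. \<exists>b\<in>B. E a b"
    and s: "0 < s" and V: "finite V" "card V \<le> 2 ^ m"
    and sym: "\<And>x y. x \<in> V \<Longrightarrow> y \<in> V \<Longrightarrow> E x y \<longleftrightarrow> E y x"
    and irrefl: "\<And>x. x \<in> V \<Longrightarrow> \<not> E x x"
    and deg: "\<And>v. v \<in> V \<Longrightarrow> card {u \<in> V. E v u} \<le> d"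
    and D: "D = (3 * s + 1) * Suc m"
    and large: "i * (D + d) + D + 1 \<le> card V" and d: "0 \<le> d"
  shows "\<exists>f :: nat \<Rightarrow> 'a. (\<forall>j\<le>i. f j \<in> V) \<and>
      (\<forall>a\<le>i. \<forall>b\<le>i. a < b \<longrightarrow> f a < f b) \<and>
      (\<forall>a\<le>i. \<forall>b\<le>i. E (f a) (f b) \<longleftrightarrow> a = b + 1 \<or> b = a + 1)"
proof -
  \<comment> \<open>A reached set omits its start; adding it makes the sets \<open>R w\<close> cover
    \<open>V\<close>. The \<open>+ 1\<close> in \<open>large\<close> pays for the start when it is
    removed again.\<close>
  define R where "R w = {w} \<inter> V \<union> reach E V w" for w
  have "(3 * s + 1) * 1 \<le> D"
    unfolding D using s by (intro mult_left_mono) auto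
  then have "2 * s + 1 \<le> D" using s by simp
  also have "\<dots> \<le> i * (D + d) + D + 1" using d s D by simp
  also note large
  finally have "2 * s + 1 \<le> card V" .
  have "\<exists>w\<in>V. card V - (3 * s + 1) * Suc m \<le> card (R w)"
  proof (rule single_vertex_reaches_most[OF dense s V(1)])
    show "R w \<subseteq> V" for w using reach_subset[of E V w] by (auto simp: R_def)
    show "y \<in> R w" if "x \<in> R w" "y \<in> V" "x < y" "E x y" for w x y
      using that reach_step[of x E V w y] reach_base[of w y E V] by (auto simp: R_def)
  qed (use V \<open>2 * s + 1 \<le> card V\<close> in \<open>auto simp: R_def\<close>)
  then obtain w where w: "w \<in> V" "card V - D \<le> card (R w)"
    unfolding D by blast
  have "card (R w) \<le> card {w} + card (reach E V w)"
    using w(1) card_Un_le[of "{w}" "reach E V w"] by (simp add: R_def)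
  then have "real (card (R w)) \<le> 1 + card (reach E V w)" by simp
  with w(2) large have reach_large: "i * (D + d) \<le> card (reach E V w)" by linarith
  have "\<exists>f :: nat \<Rightarrow> 'a. f 0 = w \<and> (\<forall>j. 0 < j \<and> j \<le> i \<longrightarrow> f j \<in> reach E V w) \<and>
      (\<forall>a\<le>i. \<forall>b\<le>i. a < b \<longrightarrow> f a < f b) \<and>
      (\<forall>a\<le>i. \<forall>b\<le>i. E (f a) (f b) \<longleftrightarrow> a = b + 1 \<or> b = a + 1)"
    by (rule induced_path_from_vertex[OF dense s V sym irrefl deg D w(1) reach_subset
        reach_within_reach reach_large])
  then obtain f :: "nat \<Rightarrow> 'a"
    where f: "f 0 = w" "\<forall>j. 0 < j \<and> j \<le> i \<longrightarrow> f j \<in> reach E V w"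
      "\<forall>a\<le>i. \<forall>b\<le>i. a < b \<longrightarrow> f a < f b"
      "\<forall>a\<le>i. \<forall>b\<le>i. E (f a) (f b) \<longleftrightarrow> a = b + 1 \<or> b = a + 1"
    by (elim exE conjE)
  have "\<forall>j\<le>i. f j \<in> V"
  proof (intro allI impI)
    fix j assume "j \<le> i"
    then show "f j \<in> V" using f(1,2) w(1) reach_subset[of E V w] by (cases j) auto
  qed
  with f(3,4) show ?thesis by (intro exI[of _ f] conjI)
qed

section \<open>Degrees and bi-cliques in the complement\<close>

lemma degree_le_max_degree: "v < n \<Longrightarrow> degree n E v \<le> max_degree n E"
  unfolding max_degree_def by (intro Max_ge) auto

text \<open>For small \<open>n\<close> the degree bound forces an empty graph. The upper bound
  \<open>2 * (n div 2)\<close> drops the last vertex when \<open>n\<close> is odd, so that both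
  sides have equal size.\<close>

lemma complement_biclique_of_empty_graph:
  assumes "\<And>u v. u < n \<Longrightarrow> v < n \<Longrightarrow> \<not> E u v"
  shows "complement_biclique n E {..<n div 2} {n div 2..<2 * (n div 2)}"
  unfolding complement_biclique_def using assms by auto

text \<open>Without an edge, trimming the larger set to the size of the smaller would give a
  bi-clique of size at least \<open>s\<close>; the order of the two sets makes them
  disjoint.\<close>

lemma exists_edge_if_no_biclique:
  fixes s :: real
  assumes no: "\<And>A B. complement_biclique n E A B \<Longrightarrow> card A < s"
    and A: "A \<subseteq> {..<n}" and B: "B \<subseteq> {..<n}" and less: "\<And>a b. a \<in> A \<Longrightarrow> b \<in> B \<Longrightarrow> a < b"
    and card: "s \<le> card A" "s \<le> card B"
  shows "\<exists>a\<in>A. \<exists>b\<in>B. E a b"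
proof (rule ccontr)
  assume noE: "\<not> ?thesis"
  define j where "j = min (card A) (card B)"
  obtain A' where A': "A' \<subseteq> A" "card A' = j"
    by (metis j_def min.cobounded1 obtain_subset_with_card_n)
  obtain B' where B': "B' \<subseteq> B" "card B' = j"
    by (metis j_def min.cobounded2 obtain_subset_with_card_n)
  have "complement_biclique n E A' B'"
    unfolding complement_biclique_def using A A' B B' noE less by fastforce
  then have "j < s" using no A'(2) by blast
  with card show False by (simp add: j_def min_def split: if_splits)
qed

section \<open>Numerical estimates\<close>

lemma ln_le_2_sqrt:
  assumes "0 < (x::real)"
  shows "ln x \<le> 2 * sqrt x"
proof -
  have "ln (sqrt x) \<le> sqrt x - 1" using assms by (intro ln_le_minus_one) auto
  moreover have "ln (sqrt x) = ln x / 2" using assms by (simp add: ln_sqrt)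
  ultimately show ?thesis by linarith
qed

lemma ln_2_ge_half: "1 / 2 \<le> ln (2::real)"
  using ln_le_minus_one[of "1/2::real"] by (simp add: ln_div)

lemma n_div_ln_le_half:
  fixes c :: real
  assumes "0 < c" "c \<le> 1 / 6" "1 \<le> n"
  shows "c * real n / ln (real n) \<le> n div 2"
\<comment> \<open>For \<open>n = 1\<close> the denominator is \<open>ln 1 = 0\<close>, and division
  by zero yields 0.\<close>
proof (cases "n = 1")
  case False
  with assms have n: "2 \<le> n" by simp
  have "ln 2 \<le> ln (real n)" using n by (subst ln_le_cancel_iff) auto
  with ln_2_ge_half have "1 / 2 \<le> ln (real n)" by linarith
  then have "c * real n / ln (real n) \<le> (1 / 6 * real n) / (1 / 2)"
    using assms by (intro frac_le mult_right_mono) auto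
  also have "\<dots> = n / 3" by simp
  also have "\<dots> \<le> n div 2"
  proof -
    have "n \<le> 3 * (n div 2)" using n by presburger
    then have "real n \<le> 3 * real (n div 2)" by linarith
    then show ?thesis by simp
  qed
  finally show ?thesis .
qed simp

text \<open>The product is at most \<open>12 * c * n + 4 * ln n\<close>. Since
  \<open>c * n \<ge> 1\<close> and \<open>c = \<delta>\<^sup>2\<close>, also
  \<open>sqrt n \<le> \<delta> * n\<close>, so the logarithm contributes at most
  \<open>8 * \<delta> * n\<close>. With the extra \<open>c * n\<close> and
  \<open>c \<le> \<delta>\<close> this makes \<open>13 + 8 = 21\<close>.\<close>

lemma block_bound:
  fixes \<delta> c :: real
  assumes \<delta>: "0 < \<delta>" "\<delta> \<le> 1 / 2" and c: "c = \<delta>\<^sup>2" "1 \<le> c * n"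
    and m: "m = nat \<lceil>log 2 (real n)\<rceil>"
    and D: "D = (3 * (c * n / ln (real n)) + 1) * Suc m"
  shows "D + c * n \<le> 21 * \<delta> * n"
proof -
  have c0: "0 < c" "c \<le> 1 / 4" "c \<le> \<delta>"
    using \<delta> mult_mono[of \<delta> "1/2" \<delta> "1/2"] mult_left_mono[of \<delta> 1 \<delta>]
    by (auto simp: c power2_eq_square)
  have "4 \<le> real n"
  proof -
    have "c * n \<le> 1 / 4 * n" using c0 by (intro mult_right_mono) auto
    with c show ?thesis by linarith
  qed
  then have "ln ((2::real) ^ 2) \<le> ln (real n)" by (subst ln_le_cancel_iff) auto
  moreover have "ln ((2::real) ^ 2) = 2 * ln 2" by (subst ln_realpow) auto
  ultimately have ln1: "1 \<le> ln (real n)" using ln_2_ge_half by linarith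
  \<comment> \<open>As \<open>ln 2 \<ge> 1 / 2\<close>, the base-2 logarithm is at most
    \<open>2 * ln n\<close>; the rounding and the successor add at most 2, absorbed by
    \<open>ln n \<ge> 1\<close>.\<close>
  have "log 2 (real n) \<le> ln (real n) / (1 / 2)"
    unfolding log_def using ln1 ln_2_ge_half by (intro frac_le) auto
  moreover have "0 \<le> log 2 (real n)" using \<open>4 \<le> real n\<close> by simp
  then have "real m \<le> log 2 (real n) + 1" unfolding m by linarith
  ultimately have m4: "real (Suc m) \<le> 4 * ln (real n)" using ln1 by simp
  have "D \<le> (3 * (c * n / ln (real n)) + 1) * (4 * ln (real n))"
    unfolding D using m4 ln1 c0 by (intro mult_left_mono) auto
  also have "\<dots> = 12 * c * n + 4 * ln (real n)" using ln1 by (simp add: field_simps)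
  also have "ln (real n) \<le> 2 * sqrt n" using \<open>4 \<le> real n\<close> by (intro ln_le_2_sqrt) auto
  also have "sqrt n \<le> \<delta> * n"
  proof (rule real_le_lsqrt)
    have "1 * real n \<le> (c * n) * n" using c by (intro mult_right_mono) auto
    then show "real n \<le> (\<delta> * real n)\<^sup>2" by (simp add: c power2_eq_square mult_ac)
  qed (use \<delta> in auto)
  finally have "D + c * n \<le> 13 * (c * n) + 8 * (\<delta> * n)" by simp
  also have "c * n \<le> \<delta> * n" using c0 by (intro mult_right_mono) auto
  finally show ?thesis by simp
qed

section \<open>Choice of constants and conclusion\<close>

theorem theorem1:
  shows "\<forall>k::nat. k \<ge> 2 \<longrightarrow> (\<exists>c::real. c > 0 \<and>
           (\<forall>n E. ordered_graph n E \<longrightarrow>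
                  real (max_degree n E) < c * real n \<longrightarrow>
                  \<not> contains_induced_monotone_path n E k \<longrightarrow>
                  (\<exists>A B. complement_biclique n E A B \<and>
                         real (card A) \<ge> c * real n / ln (real n))))"
proof (intro allI impI)
  fix k :: nat assume k: "2 \<le> k"
  \<comment> \<open>Chosen so that \<open>21 * \<delta> * n = n / k\<close>: then \<open>k\<close>
    portions of size \<open>D + c * n\<close> fit into \<open>n\<close> vertices.\<close>
  define \<delta> :: real where "\<delta> = 1 / (21 * k)"
  define c where "c = \<delta>\<^sup>2"
  have \<delta>: "0 < \<delta>" "\<delta> \<le> 1 / 6" using k by (auto simp: \<delta>_def field_simps)
  have c: "0 < c" "c \<le> 1 / 6"
    using \<delta> mult_mono[of \<delta> "1/6" \<delta> "1"] by (auto simp: c_def power2_eq_square)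
  show "\<exists>c::real. c > 0 \<and>
           (\<forall>n E. ordered_graph n E \<longrightarrow>
                  real (max_degree n E) < c * real n \<longrightarrow>
                  \<not> contains_induced_monotone_path n E k \<longrightarrow>
                  (\<exists>A B. complement_biclique n E A B \<and>
                         real (card A) \<ge> c * real n / ln (real n)))"
  proof (intro exI[of _ c] conjI allI impI)
    show "0 < c" by (rule c)
    fix n E
    assume G: "ordered_graph n E" and \<Delta>: "real (max_degree n E) < c * real n"
      and no_path: "\<not> contains_induced_monotone_path n E k"
    have deg: "card {u \<in> {..<n}. E v u} \<le> c * n" if "v \<in> {..<n}" for v
      using degree_le_max_degree[of v n E] \<Delta> that by (simp add: degree_def)
    have sym: "E x y \<longleftrightarrow> E y x" if "x \<in> {..<n}" "y \<in> {..<n}" for x y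
      using G that by (auto simp: ordered_graph_def)
    have irrefl: "\<not> E x x" if "x \<in> {..<n}" for x
      using G that by (auto simp: ordered_graph_def)
    have n: "1 \<le> n" using \<Delta> by (cases n) auto
    show "\<exists>A B. complement_biclique n E A B \<and> real (card A) \<ge> c * real n / ln (real n)"
    \<comment> \<open>In the first case all degrees are below 1, so there are no edges at
      all.\<close>
    proof (cases "c * n < 1")
      case True
      have "\<not> E u v" if "u < n" "v < n" for u v
      proof
        assume "E u v"
        then have "{u \<in> {..<n}. E u v} \<noteq> {}" "{v \<in> {..<n}. E u v} \<noteq> {}" using that by auto
        then have "1 \<le> card {v \<in> {..<n}. E u v}" by (simp add: Suc_le_eq card_gt_0_iff)
        with deg[of u] that True show False by simp
      qed
      then have "complement_biclique n E {..<n div 2} {n div 2..<2 * (n div 2)}"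
        by (rule complement_biclique_of_empty_graph)
      then show ?thesis using n_div_ln_le_half[OF c n] by (intro exI conjI) auto
    next
      case False
      show ?thesis
      proof (rule ccontr)
        define s where "s = c * n / ln (real n)"
        define m where "m = nat \<lceil>log 2 (real n)\<rceil>"
        define D where "D = (3 * s + 1) * Suc m"
        assume "\<not> ?thesis"
        then have no: "card A < s" if "complement_biclique n E A B" for A B
          using that by (force simp: s_def)
        have edge: "\<exists>a\<in>A. \<exists>b\<in>B. E a b"
          if "A \<subseteq> {..<n}" "B \<subseteq> {..<n}" "\<And>a b. a \<in> A \<Longrightarrow> b \<in> B \<Longrightarrow> a < b"
            "s \<le> card A" "s \<le> card B" for A B
          using exists_edge_if_no_biclique[of n E s A B] no that by blast
        \<comment> \<open>A single vertex would give \<open>c * n < 1\<close>; with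
          \<open>n \<ge> 2\<close> the logarithm is positive, and hence so is
          \<open>s\<close>.\<close>
        have n2: "2 \<le> n"
          using False c n by (cases "n = 1") auto
        then have s: "0 < s" using c by (simp add: s_def)
        have "log 2 (real n) \<le> m" by (simp add: m_def) linarith
        then have "real n \<le> 2 ^ m"
          using n by (simp add: log_le_iff powr_realpow)
        then have nm: "card {..<n} \<le> 2 ^ m" by (metis card_lessThan of_nat_le_iff of_nat_numeral of_nat_power)
        have "D + c * n \<le> 21 * \<delta> * n"
          by (rule block_bound[OF \<delta>(1) _ c_def _ m_def]) (use \<delta> False in \<open>auto simp: D_def s_def\<close>)
        then have "k * (D + c * n) \<le> k * (21 * \<delta> * n)"
          by (intro mult_left_mono) auto
        also have "\<dots> = n" using k by (simp add: \<delta>_def)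
        \<comment> \<open>The path has \<open>k - 1\<close> edges. The remaining portion
          \<open>D + c * n\<close> pays for \<open>D + 1\<close> because
          \<open>c * n \<ge> 1\<close>.\<close>
        finally have large: "(k - 1) * (D + c * n) + D + 1 \<le> card {..<n}"
          using False k by (simp add: of_nat_diff algebra_simps)
        have "\<exists>f :: nat \<Rightarrow> nat. (\<forall>j\<le>k - 1. f j \<in> {..<n}) \<and>
            (\<forall>a\<le>k - 1. \<forall>b\<le>k - 1. a < b \<longrightarrow> f a < f b) \<and>
            (\<forall>a\<le>k - 1. \<forall>b\<le>k - 1. E (f a) (f b) \<longleftrightarrow> a = b + 1 \<or> b = a + 1)"
          by (rule induced_path_if_no_sparse_pair[OF edge s finite_lessThan nm sym irrefl deg D_def
                large])
            (use c in auto)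
        then obtain f :: "nat \<Rightarrow> nat" where f: "\<forall>j\<le>k - 1. f j \<in> {..<n}"
            "\<forall>a\<le>k - 1. \<forall>b\<le>k - 1. a < b \<longrightarrow> f a < f b"
            "\<forall>a\<le>k - 1. \<forall>b\<le>k - 1. E (f a) (f b) \<longleftrightarrow> a = b + 1 \<or> b = a + 1"
          by (elim exE conjE)
        have "i \<le> k - 1" if "i < k" for i using that by simp
        with f have "contains_induced_monotone_path n E k"
          unfolding contains_induced_monotone_path_def by (intro exI[of _ f]) auto
        with no_path show False ..
      qed
    qed
  qed
qed

end
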